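(* Let $(\mathbf{W},\mathbf{w})$ be a fusion frame for $\mathcal{H}$, let $\mathbf{v}=\{v_i\}_{i=1}^m$ be a family of weights and let $r\in\{1,\ldots,m\}$. Let $D:\mathcal{W}\to\mathcal{W}$, $D(f_i)_{i=1}^m=(\frac{1}{w_iv_i}f_i)_{i=1}^m$, and $S_D=T_{\mathbf{W},\mathbf{v}}DT^*_{\mathbf{W},\mathbf{w}}$. Then $S_D$ is a selfadjoint positive invertible operator, and if $Q_D:\mathcal{W}\to\bigoplus_{j=1}^mS_D^{-1}W_j$, $Q_D(f_j)_{j=1}^m=(\frac{1}{w_jv_j}S_D^{-1}f_j)_{j=1}^m$, then: (1) $(S_D^{-1}\mathbf{W},\mathbf{v})$ is an $(r,2)$-loss optimal component preserving $Q_D$-dual fusion frame for $(\mathbf{W},\mathbf{w})$. (2) If $(\mathbf{V},\mathbf{v})$ is an $(r,2)$-loss optimal $Q$-dual fusion frame of $(\mathbf{W},\mathbf{w})$, then $T_{\mathbf{V},\mathbf{v}}Q=T_{S_D^{-1}\mathbf{W},\mathbf{v}}Q_D$. (3) If $(\mathbf{V},\mathbf{v})$ is an $(r,2)$-loss optimal $Q$-component preserving dual fusion frame of $(\mathbf{W},\mathbf{w})$, then $\mathbf{V}=S_D^{-1}\mathbf{W}$ and $Q=Q_D$. (4) If $w_i=w$ for $i=1,\ldots,m$, then $S_D^{-1}\mathbf{W}=S_{\mathbf{W},w}^{-1}\mathbf{W}$ and $Q_D=Q_{S_{\mathbf{W},w}^{-1}T_{\mathbf{W},w},\mathbf{v}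}$.
   Context: $\mathcal{H}$ is a finite-dimensional Hilbert space over $\mathbb{F}=\mathbb{R}$ or $\mathbb{C}$, $m\in\mathbb{N}$; $L(\mathcal{X},\mathcal{Y})$ is the space of linear maps $\mathcal{X}\to\mathcal{Y}$ and $\|\cdot\|_F$ the Frobenius norm. A Bessel fusion sequence $(\mathbf{W},\mathbf{w})=\{(W_i,w_i)\}_{i=1}^m$ is a family of subspaces $W_i$ of $\mathcal{H}$ with weights $w_i>0$; write $(\mathbf{W},w)$ if all $w_i=w$, and $(T\mathbf{W},\mathbf{w})=\{(TW_i,w_i)\}_i$. Put $\mathcal{W}=\bigoplus_{i=1}^m W_i$ (external direct sum, with inner product $\sum_i\langle f_i,g_i\rangle$); similarly $\mathcal{V}=\bigoplus_iV_i$. Let $T_{\mathbf{W},\mathbf{w}}:\mathcal{W}\to\mathcal{H}$, $T_{\mathbf{W},\mathbf{w}}(f_i)_i=\sum_iw_if_i$, with adjoint $T^*_{\mathbf{W},\mathbf{w}}f=(w_i\pi_{W_i}f)_i$, $\pi_{W_i}$ the orthogonal projection onto $W_i$. $(\mathbf{W},\mathbf{w})$ is a fusion frame for $\mathcal{H}$ if $\mathrm{span}\bigcup_iW_i=\mathcal{H}$; then $S_{\mathbf{W},\mathbf{w}}=T_{\mathbf{W},\mathbf{w}}T^*_{\mathbf{W},\mathbf{w}}$ is its (invertible) fusion frame operator. For $J\subseteq\{1,\ldots,m\}$, $M_J=M_{J,\mathbf{W}}:\mathcal{W}\to\mathcal{W}$ keeps the components with index in $J$ and replaces the others by $0$; $M_j=M_{\{j\}}$;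 similarly on $\mathcal{V}$. $Q\in L(\mathcal{W},\mathcal{V})$ is component preserving if $QM_{j,\mathbf{W}}\mathcal{W}=M_{j,\mathbf{V}}\mathcal{V}$ for each $j$. A fusion frame $(\mathbf{V},\mathbf{v})$ for $\mathcal{H}$ is a $Q$-dual fusion frame of $(\mathbf{W},\mathbf{w})$ ($Q\in L(\mathcal{W},\mathcal{V})$) if $T_{\mathbf{V},\mathbf{v}}QT^*_{\mathbf{W},\mathbf{w}}=I_{\mathcal{H}}$, and a $Q$-component preserving dual fusion frame if moreover $Q$ is component preserving. For $A\in L(\mathcal{W},\mathcal{H})$ and weights $\mathbf{v}$, $Q_{A,\mathbf{v}}:\mathcal{W}\to\bigoplus_iAM_i\mathcal{W}$ is $Q_{A,\mathbf{v}}(f_j)_j=(\frac{1}{v_i}AM_i(f_j)_j)_{i}$. Loss optimality: let $\mathcal{P}_r^m=\{J\subseteq\{1,\ldots,m\}:|J|=r\}$. For a $Q$-dual fusion frame $(\mathbf{V},\mathbf{v})$ of $(\mathbf{W},\mathbf{w})$ put $e(r,(\mathbf{W},\mathbf{w}),(\mathbf{V},\mathbf{v}),Q)=(\|T_{\mathbf{V},\mathbf{v}}QM_JT^*_{\mathbf{W},\mathbf{w}}\|_F)_{J\in\mathcal{P}_r^m}$. For $p\in\mathbb{N}\cup\{\infty\}$, with $\|\cdot\|_p$ the usual $p$-norm, define inductively: $e_1^{(p)}(\mathbf{W},\mathbf{w})$ is the infimum of $\|e(1,(\mathbf{W},\mathbf{w}),(\mathbf{V},\mathbf{v}),Q)\|_p$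 over all pairs $((\mathbf{V},\mathbf{v}),Q)$ (with arbitrary subspaces $\mathbf{V}$, weights $\mathbf{v}$, and $Q$) such that $(\mathbf{V},\mathbf{v})$ is a $Q$-dual fusion frame of $(\mathbf{W},\mathbf{w})$, and $\mathcal{D}_1^{(p)}(\mathbf{W},\mathbf{w})$ is the set of pairs attaining it; for $r\geq2$, $e_r^{(p)}(\mathbf{W},\mathbf{w})$ is the infimum of $\|e(r,(\mathbf{W},\mathbf{w}),(\mathbf{V},\mathbf{v}),Q)\|_p$ over $((\mathbf{V},\mathbf{v}),Q)\in\mathcal{D}_{r-1}^{(p)}(\mathbf{W},\mathbf{w})$, and $\mathcal{D}_r^{(p)}(\mathbf{W},\mathbf{w})$ is the set of pairs in $\mathcal{D}_{r-1}^{(p)}(\mathbf{W},\mathbf{w})$ attaining it. A $Q$-dual fusion frame $(\mathbf{V},\mathbf{v})$ is $(r,p)$-loss optimal for $(\mathbf{W},\mathbf{w})$ if $((\mathbf{V},\mathbf{v}),Q)\in\mathcal{D}_r^{(p)}(\mathbf{W},\mathbf{w})$. *)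

theory Defs
  imports "HOL-Analysis.Analysis" "HOL-Library.Extended_Nat"
begin

section \<open>Scalars and finite-dimensional Hilbert spaces\<close>

text \<open>
  The scalar field is \<open>\<real>\<close> or \<open>\<complex>\<close>. The type class has exactly these two models (up to
  isomorphism over the reals), so a type variable of this class ranges over both cases.
\<close>

class real_or_complex = real_field +
  fixes to_complex :: "'a \<Rightarrow> complex"
  assumes to_complex_add: "to_complex (x + y) = to_complex x + to_complex y"
    and to_complex_mult: "to_complex (x * y) = to_complex x * to_complex y"
    and to_complex_scaleR: "to_complex (r *\<^sub>R x) = r *\<^sub>R to_complex x"
    and inj_to_complex: "inj to_complex"
    and range_to_complex: "range to_complex = \<real> \<or> range to_complex = UNIV"

instantiation real :: real_or_complex
begin
definition to_complex_real :: "real \<Rightarrow> complex" where "to_complex_real = complex_of_real"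
instance
proof
  show "range (to_complex :: real \<Rightarrow> complex) = \<real> \<or> range (to_complex :: real \<Rightarrow> complex) = UNIV"
    by (simp only: to_complex_real_def Reals_def simp_thms)
qed (simp_all add: to_complex_real_def inj_on_def scaleR_conv_of_real)
end

instantiation complex :: real_or_complex
begin
definition to_complex_complex :: "complex \<Rightarrow> complex" where "to_complex_complex = id"
instance
  by standard (simp_all add: to_complex_complex_def)
end

record ('k, 'h) hilbert_space =
  smul :: "'k \<Rightarrow> 'h \<Rightarrow> 'h"
  ip :: "'h \<Rightarrow> 'h \<Rightarrow> 'k"

text \<open>
  The space is the whole type \<open>'h\<close>, which may be trivial. The inner product is linear in
  its first argument. Completeness is automatic in finite dimension.
\<close>

locale fd_hilbert =
  fixes H :: "('k::real_or_complex, 'h::ab_group_add) hilbert_space"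
  assumes vector_space_smul: "vector_space (smul H)"
    and finite_dim: "\<exists>B. finite B \<and> module.span (smul H) B = UNIV"
    and ip_add_left: "ip H (x + y) z = ip H x z + ip H y z"
    and ip_smul_left: "ip H (smul H c x) z = c * ip H x z"
    and ip_commute: "to_complex (ip H x y) = cnj (to_complex (ip H y x))"
    and ip_pos: "x \<noteq> 0 \<Longrightarrow> 0 < Re (to_complex (ip H x x))"

definition hnorm :: "('k::real_or_complex, 'h) hilbert_space \<Rightarrow> 'h \<Rightarrow> real" where
  "hnorm H x = sqrt (Re (to_complex (ip H x x)))"

definition linear_op :: "('k::real_or_complex, 'h::ab_group_add) hilbert_space \<Rightarrow> ('h \<Rightarrow> 'h) \<Rightarrow> bool" where
  "linear_op H A \<longleftrightarrow> Vector_Spaces.linear (smul H) (smul H) A"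

definition selfadjoint :: "('k::real_or_complex, 'h) hilbert_space \<Rightarrow> ('h \<Rightarrow> 'h) \<Rightarrow> bool" where
  "selfadjoint H A \<longleftrightarrow> (\<forall>x y. ip H (A x) y = ip H x (A y))"

definition positive_op :: "('k::real_or_complex, 'h) hilbert_space \<Rightarrow> ('h \<Rightarrow> 'h) \<Rightarrow> bool" where
  "positive_op H A \<longleftrightarrow> (\<forall>x. to_complex (ip H (A x) x) \<in> \<real>\<^sub>\<ge>\<^sub>0)"

definition orthonormal_basis :: "('k::real_or_complex, 'h::ab_group_add) hilbert_space \<Rightarrow> 'h set \<Rightarrow> bool" where
  "orthonormal_basis H B \<longleftrightarrow> finite B \<and> module.span (smul H) B = UNIV \<and>
     (\<forall>b\<in>B. \<forall>c\<in>B. ip H b c = (if b = c then 1 else 0))"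

text \<open>
  The square root of \<open>tr (A\<^sup>* A)\<close>, computed in an orthonormal basis; see
  \<open>frob_norm_eq\<close> below for the independence of the basis.
\<close>

definition frob_norm :: "('k::real_or_complex, 'h::ab_group_add) hilbert_space \<Rightarrow> ('h \<Rightarrow> 'h) \<Rightarrow> real" where
  "frob_norm H A = sqrt (\<Sum>b\<in>(SOME B. orthonormal_basis H B). (hnorm H (A b))\<^sup>2)"

definition orth_proj :: "('k::real_or_complex, 'h::ab_group_add) hilbert_space \<Rightarrow> 'h set \<Rightarrow> 'h \<Rightarrow> 'h" where
  "orth_proj H U x = (THE p. p \<in> U \<and> (\<forall>u\<in>U. ip H (x - p) u = 0))"


section \<open>Fusion frames\<close>

text \<open>
  Families are indexed by a finite type \<open>'m\<close>, so \<open>m = CARD('m)\<close>. An element of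
  \<open>\<Oplus>\<^sub>i W\<^sub>i\<close> is a function \<open>f\<close> with \<open>f i \<in> W i\<close>. Maps out of a direct sum are total
  functions whose values outside of the direct sum are irrelevant.
\<close>

definition direct_sum :: "('m \<Rightarrow> 'h set) \<Rightarrow> ('m \<Rightarrow> 'h) set" where
  "direct_sum W = {f. \<forall>i. f i \<in> W i}"

definition direct_sum_ip :: "('k::real_or_complex, 'h) hilbert_space \<Rightarrow> ('m::finite \<Rightarrow> 'h) \<Rightarrow> ('m \<Rightarrow> 'h) \<Rightarrow> 'k" where
  "direct_sum_ip H f g = (\<Sum>i\<in>UNIV. ip H (f i) (g i))"

definition direct_sum_linear ::
  "('k::real_or_complex, 'h::ab_group_add) hilbert_space \<Rightarrow> ('m \<Rightarrow> 'h set) \<Rightarrow> ('m \<Rightarrow> 'h set) \<Rightarrow>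
     (('m \<Rightarrow> 'h) \<Rightarrow> ('m \<Rightarrow> 'h)) \<Rightarrow> bool" where
  "direct_sum_linear H W V Q \<longleftrightarrow>
     (\<forall>f\<in>direct_sum W. Q f \<in> direct_sum V) \<and>
     (\<forall>f\<in>direct_sum W. \<forall>g\<in>direct_sum W. Q (\<lambda>i. f i + g i) = (\<lambda>i. Q f i + Q g i)) \<and>
     (\<forall>c. \<forall>f\<in>direct_sum W. Q (\<lambda>i. smul H c (f i)) = (\<lambda>i. smul H c (Q f i)))"

definition bessel_fusion_sequence ::
  "('k::real_or_complex, 'h::ab_group_add) hilbert_space \<Rightarrow> ('m \<Rightarrow> 'h set) \<Rightarrow> ('m \<Rightarrow> real) \<Rightarrow> bool" where
  "bessel_fusion_sequence H W w \<longleftrightarrow>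
     (\<forall>i. module.subspace (smul H) (W i)) \<and> (\<forall>i. w i > 0)"

definition fusion_frame ::
  "('k::real_or_complex, 'h::ab_group_add) hilbert_space \<Rightarrow> ('m \<Rightarrow> 'h set) \<Rightarrow> ('m \<Rightarrow> real) \<Rightarrow> bool" where
  "fusion_frame H W w \<longleftrightarrow>
     bessel_fusion_sequence H W w \<and> module.span (smul H) (\<Union>i. W i) = UNIV"

text \<open>
  The formula for \<open>T\<^bsub>W,w\<^esub>\<close> does not involve \<open>W\<close>; the subspaces only determine its domain
  \<open>direct_sum W\<close>. The analysis operator is the adjoint of its restriction to \<open>direct_sum W\<close>; see
  \<open>analysis_adjoint\<close>.
\<close>

definition synthesis ::
  "('k::real_or_complex, 'h::ab_group_add) hilbert_space \<Rightarrow> ('m::finite \<Rightarrow> real) \<Rightarrow> ('m \<Rightarrow> 'h) \<Rightarrow> 'h" where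
  "synthesis H w f = (\<Sum>i\<in>UNIV. smul H (of_real (w i)) (f i))"

definition analysis ::
  "('k::real_or_complex, 'h::ab_group_add) hilbert_space \<Rightarrow> ('m::finite \<Rightarrow> 'h set) \<Rightarrow> ('m \<Rightarrow> real) \<Rightarrow>
     'h \<Rightarrow> ('m \<Rightarrow> 'h)" where
  "analysis H W w x = (\<lambda>i. smul H (of_real (w i)) (orth_proj H (W i) x))"

definition frame_op ::
  "('k::real_or_complex, 'h::ab_group_add) hilbert_space \<Rightarrow> ('m::finite \<Rightarrow> 'h set) \<Rightarrow> ('m \<Rightarrow> real) \<Rightarrow> 'h \<Rightarrow> 'h" where
  "frame_op H W w x = synthesis H w (analysis H W w x)"

definition keep :: "'m set \<Rightarrow> ('m \<Rightarrow> 'h::zero) \<Rightarrow> ('m \<Rightarrow> 'h)" where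
  "keep J f = (\<lambda>i. if i \<in> J then f i else 0)"


section \<open>Dual fusion frames\<close>

definition component_preserving ::
  "('m \<Rightarrow> 'h::zero set) \<Rightarrow> ('m \<Rightarrow> 'h set) \<Rightarrow> (('m \<Rightarrow> 'h) \<Rightarrow> ('m \<Rightarrow> 'h)) \<Rightarrow> bool" where
  "component_preserving W V Q \<longleftrightarrow> (\<forall>j. Q ` keep {j} ` direct_sum W = keep {j} ` direct_sum V)"

definition dual_fusion_frame ::
  "('k::real_or_complex, 'h::ab_group_add) hilbert_space \<Rightarrow> ('m::finite \<Rightarrow> 'h set) \<Rightarrow> ('m \<Rightarrow> real) \<Rightarrow>
     ('m \<Rightarrow> 'h set) \<Rightarrow> ('m \<Rightarrow> real) \<Rightarrow> (('m \<Rightarrow> 'h) \<Rightarrow> ('m \<Rightarrow> 'h)) \<Rightarrow> bool" where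
  "dual_fusion_frame H W w V v Q \<longleftrightarrow>
     fusion_frame H V v \<and> direct_sum_linear H W V Q \<and> (\<forall>x. synthesis H v (Q (analysis H W w x)) = x)"

definition cp_dual_fusion_frame ::
  "('k::real_or_complex, 'h::ab_group_add) hilbert_space \<Rightarrow> ('m::finite \<Rightarrow> 'h set) \<Rightarrow> ('m \<Rightarrow> real) \<Rightarrow>
     ('m \<Rightarrow> 'h set) \<Rightarrow> ('m \<Rightarrow> real) \<Rightarrow> (('m \<Rightarrow> 'h) \<Rightarrow> ('m \<Rightarrow> 'h)) \<Rightarrow> bool" where
  "cp_dual_fusion_frame H W w V v Q \<longleftrightarrow>
     dual_fusion_frame H W w V v Q \<and> component_preserving W V Q"

text \<open>
  \<open>Q\<^bsub>A,v\<^esub>\<close> and the family \<open>(A M\<^sub>i (\<Oplus>\<^sub>j W\<^sub>j))\<^sub>i\<close> of subspaces whose direct sum is its codomain.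
\<close>

definition Q_of ::
  "('k::real_or_complex, 'h::zero) hilbert_space \<Rightarrow> (('m \<Rightarrow> 'h) \<Rightarrow> 'h) \<Rightarrow> ('m \<Rightarrow> real) \<Rightarrow>
     ('m \<Rightarrow> 'h) \<Rightarrow> ('m \<Rightarrow> 'h)" where
  "Q_of H A v f = (\<lambda>i. smul H (of_real (1 / v i)) (A (keep {i} f)))"

definition Q_of_spaces :: "('m \<Rightarrow> 'h::zero set) \<Rightarrow> (('m \<Rightarrow> 'h) \<Rightarrow> 'h) \<Rightarrow> 'm \<Rightarrow> 'h set" where
  "Q_of_spaces W A = (\<lambda>i. A ` keep {i} ` direct_sum W)"


section \<open>Loss optimality\<close>

text \<open>
  The usual \<open>p\<close>-norm of a finite real family, for \<open>1 \<le> p \<le> \<infinity>\<close>.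
\<close>

definition p_norm :: "enat \<Rightarrow> 'a set \<Rightarrow> ('a \<Rightarrow> real) \<Rightarrow> real" where
  "p_norm p I x = (case p of
       enat n \<Rightarrow> root n (\<Sum>i\<in>I. \<bar>x i\<bar> ^ n)
     | \<infinity> \<Rightarrow> Max ((\<lambda>i. \<bar>x i\<bar>) ` I))"

definition loss ::
  "('k::real_or_complex, 'h::ab_group_add) hilbert_space \<Rightarrow> ('m::finite \<Rightarrow> 'h set) \<Rightarrow> ('m \<Rightarrow> real) \<Rightarrow>
     ('m \<Rightarrow> 'h set) \<times> ('m \<Rightarrow> real) \<times> (('m \<Rightarrow> 'h) \<Rightarrow> ('m \<Rightarrow> 'h)) \<Rightarrow> 'm set \<Rightarrow> real" where
  "loss H W w = (\<lambda>(V, v, Q) J.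
     frob_norm H (\<lambda>x. synthesis H v (Q (keep J (analysis H W w x)))))"

definition loss_norm ::
  "('k::real_or_complex, 'h::ab_group_add) hilbert_space \<Rightarrow> enat \<Rightarrow> nat \<Rightarrow>
     ('m::finite \<Rightarrow> 'h set) \<Rightarrow> ('m \<Rightarrow> real) \<Rightarrow>
     ('m \<Rightarrow> 'h set) \<times> ('m \<Rightarrow> real) \<times> (('m \<Rightarrow> 'h) \<Rightarrow> ('m \<Rightarrow> 'h)) \<Rightarrow> real" where
  "loss_norm H p r W w d = p_norm p {J. card J = r} (loss H W w d)"

text \<open>
  The stage \<open>0\<close> consists of all dual pairs, so that the infima defining stage \<open>1\<close> and the later
  stages are both taken over the preceding stage.
\<close>

primrec optimal_duals ::
  "('k::real_or_complex, 'h::ab_group_add) hilbert_space \<Rightarrow> enat \<Rightarrow>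
     ('m::finite \<Rightarrow> 'h set) \<Rightarrow> ('m \<Rightarrow> real) \<Rightarrow> nat \<Rightarrow>
     (('m \<Rightarrow> 'h set) \<times> ('m \<Rightarrow> real) \<times> (('m \<Rightarrow> 'h) \<Rightarrow> ('m \<Rightarrow> 'h))) set" where
  "optimal_duals H p W w 0 = {(V, v, Q). dual_fusion_frame H W w V v Q}"
| "optimal_duals H p W w (Suc r) =
     {d \<in> optimal_duals H p W w r.
        loss_norm H p (Suc r) W w d =
          (INF d'\<in>optimal_duals H p W w r. loss_norm H p (Suc r) W w d')}"

definition loss_optimal ::
  "('k::real_or_complex, 'h::ab_group_add) hilbert_space \<Rightarrow> nat \<Rightarrow> enat \<Rightarrow>
     ('m::finite \<Rightarrow> 'h set) \<Rightarrow> ('m \<Rightarrow> real) \<Rightarrow>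
     ('m \<Rightarrow> 'h set) \<Rightarrow> ('m \<Rightarrow> real) \<Rightarrow> (('m \<Rightarrow> 'h) \<Rightarrow> ('m \<Rightarrow> 'h)) \<Rightarrow> bool" where
  "loss_optimal H r p W w V v Q \<longleftrightarrow> (V, v, Q) \<in> optimal_duals H p W w r"


section \<open>The operators \<open>D\<close>, \<open>S\<^sub>D\<close> and \<open>Q\<^sub>D\<close>\<close>

definition D_op ::
  "('k::real_or_complex, 'h) hilbert_space \<Rightarrow> ('m \<Rightarrow> real) \<Rightarrow> ('m \<Rightarrow> real) \<Rightarrow> ('m \<Rightarrow> 'h) \<Rightarrow> ('m \<Rightarrow> 'h)" where
  "D_op H w v f = (\<lambda>i. smul H (of_real (1 / (w i * v i))) (f i))"

definition S_D ::
  "('k::real_or_complex, 'h::ab_group_add) hilbert_space \<Rightarrow> ('m::finite \<Rightarrow> 'h set) \<Rightarrow>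
     ('m \<Rightarrow> real) \<Rightarrow> ('m \<Rightarrow> real) \<Rightarrow> 'h \<Rightarrow> 'h" where
  "S_D H W w v x = synthesis H v (D_op H w v (analysis H W w x))"

definition Q_D ::
  "('k::real_or_complex, 'h::ab_group_add) hilbert_space \<Rightarrow> ('m::finite \<Rightarrow> 'h set) \<Rightarrow>
     ('m \<Rightarrow> real) \<Rightarrow> ('m \<Rightarrow> real) \<Rightarrow> ('m \<Rightarrow> 'h) \<Rightarrow> ('m \<Rightarrow> 'h)" where
  "Q_D H W w v f = (\<lambda>j. smul H (of_real (1 / (w j * v j))) (inv (S_D H W w v) (f j)))"


section \<open>Well-definedness of the notions above\<close>

lemma to_complex_of_real: "to_complex (of_real r :: 'k::real_or_complex) = complex_of_real r"
proof -
  have "to_complex (0::'k) = 0" using to_complex_add[of 0 "0::'k"] by simp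
  then have "to_complex (1::'k) \<noteq> 0"
    using inj_to_complex[where ?'a='k] by (metis injD zero_neq_one)
  then have "to_complex (1::'k) = 1" using to_complex_mult[of 1 "1::'k"] by simp
  then show ?thesis by (simp add: of_real_def to_complex_scaleR)
qed

context fd_hilbert
begin

interpretation vs: vector_space "smul H" by (rule vector_space_smul)

lemma to_complex_0 [simp]: "to_complex (0::'k) = 0"
  using to_complex_of_real[of 0] by (metis of_real_0)

lemma to_complex_eq_iff: "to_complex (a::'k) = to_complex b \<longleftrightarrow> a = b"
  using inj_to_complex by (auto simp: inj_def)

lemma ip_0_left [simp]: "ip H 0 z = 0"
  using ip_add_left[of 0 0 z] by simp

lemma ip_0_right [simp]: "ip H z 0 = 0"
  using ip_commute[of z 0] to_complex_eq_iff[of "ip H z 0" 0] by simp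

lemma ip_minus_left: "ip H (- x) z = - ip H x z"
  using ip_add_left[of "- x" x z] by (simp add: eq_neg_iff_add_eq_0)

lemma ip_diff_left: "ip H (x - y) z = ip H x z - ip H y z"
  using ip_add_left[of x "- y" z] by (simp add: ip_minus_left)

lemma ip_add_right: "ip H x (y + z) = ip H x y + ip H x z"
proof -
  have "to_complex (ip H x (y + z)) = to_complex (ip H x y + ip H x z)"
    by (simp add: ip_commute[of x] ip_add_left to_complex_add)
  then show ?thesis by (simp only: to_complex_eq_iff)
qed

lemma ip_eq_0_commute: "ip H x y = 0 \<longleftrightarrow> ip H y x = 0"
  by (metis ip_commute to_complex_eq_iff to_complex_0 complex_cnj_zero)

lemma ip_eq_0_iff: "ip H x x = 0 \<longleftrightarrow> x = 0"
  using ip_pos[of x] by fastforce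

lemma ip_smul_right: "ip H x (smul H (of_real r) y) = of_real r * ip H x y"
proof -
  have "to_complex (ip H x (smul H (of_real r) y)) = to_complex (of_real r * ip H x y)"
    by (simp add: ip_commute[of x] ip_smul_left to_complex_mult to_complex_of_real)
  then show ?thesis by (simp only: to_complex_eq_iff)
qed

lemma ip_sum_left: "ip H (\<Sum>i\<in>I. f i) z = (\<Sum>i\<in>I. ip H (f i) z)"
  by (induction I rule: infinite_finite_induct) (auto simp: ip_add_left)

lemma ip_sum_right: "ip H z (\<Sum>i\<in>I. f i) = (\<Sum>i\<in>I. ip H z (f i))"
  by (induction I rule: infinite_finite_induct) (auto simp: ip_add_right)

lemma orth_complement_subspace: "vs.subspace {u. ip H u x = 0}"
  by (rule vs.subspaceI) (auto simp: ip_add_left ip_smul_left)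

lemma orth_span:
  assumes "\<forall>b\<in>B. ip H x b = 0" and "u \<in> vs.span B"
  shows "ip H x u = 0"
proof -
  have "vs.span B \<subseteq> {u. ip H u x = 0}"
    by (rule vs.span_minimal[OF _ orth_complement_subspace])
      (use assms(1) ip_eq_0_commute in auto)
  with assms(2) ip_eq_0_commute show ?thesis by auto
qed

lemma unit_vector:
  assumes "x \<noteq> 0"
  obtains c :: 'k where "c \<noteq> 0" and "ip H (smul H c x) (smul H c x) = 1"
proof -
  define r where "r = Re (to_complex (ip H x x))"
  have r: "r > 0" using ip_pos[OF assms] by (simp add: r_def)
  have "to_complex (ip H x x) = complex_of_real r"
    using ip_commute[of x x] by (simp add: r_def complex_eq_iff)
  then have x: "ip H x x = of_real r"
    by (metis to_complex_eq_iff to_complex_of_real)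
  define s where "s = 1 / sqrt r"
  have "ip H (smul H (of_real s) x) (smul H (of_real s) x) = of_real (s * s * r)"
    by (simp add: ip_smul_left ip_smul_right x)
  also have "s * s * r = 1" using r by (simp add: s_def)
  finally have "ip H (smul H (of_real s) x) (smul H (of_real s) x) = 1" by simp
  moreover have "(of_real s :: 'k) \<noteq> 0" using r by (simp add: s_def)
  ultimately show thesis using that by blast
qed

lemma orthonormal_span:
  assumes "finite B"
  obtains E where "finite E" and "vs.span E = vs.span B"
    and "\<forall>b\<in>E. \<forall>c\<in>E. ip H b c = (if b = c then 1 else 0)"
proof -
  have "\<exists>E. finite E \<and> vs.span E = vs.span B \<and>
          (\<forall>b\<in>E. \<forall>c\<in>E. ip H b c = (if b = c then 1 else 0))"
    using assms
  proof (induction B rule: finite_induct)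
    case empty
    then show ?case by (intro exI[of _ "{}"]) auto
  next
    case (insert a B)
    then obtain E where E: "finite E" "vs.span E = vs.span B"
      and on: "\<forall>b\<in>E. \<forall>c\<in>E. ip H b c = (if b = c then 1 else 0)" by blast
    define p where "p = (\<Sum>e\<in>E. smul H (ip H a e) e)"
    have p: "p \<in> vs.span E"
      unfolding p_def by (intro vs.span_sum vs.span_scale vs.span_base)
    have orth: "ip H (a - p) b = 0" if "b \<in> E" for b
    proof -
      have "ip H p b = (\<Sum>e\<in>E. if e = b then ip H a e else 0)"
        unfolding p_def ip_sum_left ip_smul_left using on that by (intro sum.cong) auto
      then show ?thesis using that E(1) by (simp add: ip_diff_left)
    qed
    show ?case
    proof (cases "a = p")
      case True
      then have "vs.span (insert a B) = vs.span E"
        using p E(2) vs.span_redundant by force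
      with E(1) on show ?thesis by metis
    next
      case False
      then obtain c where c: "c \<noteq> 0" "ip H (smul H c (a - p)) (smul H c (a - p)) = 1"
        using unit_vector[of "a - p"] by auto
      define e where "e = smul H c (a - p)"
      have e: "ip H e b = 0" "ip H b e = 0" if "b \<in> E" for b
      proof -
        show "ip H e b = 0" using orth[OF that] by (simp add: e_def ip_smul_left)
        then show "ip H b e = 0" by (simp add: ip_eq_0_commute[of b e])
      qed
      have "vs.span (insert e E) = vs.span (insert a B)"
      proof (rule vs.span_eq[THEN iffD2], intro conjI subsetI)
        fix x assume x: "x \<in> insert e E"
        have sub: "vs.span E \<subseteq> vs.span (insert a B)"
          unfolding E(2) by (rule vs.span_mono) auto
        have "e \<in> vs.span (insert a B)"
          unfolding e_def
          by (intro vs.span_scale vs.span_diff) (use vs.span_base sub p in auto)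
        with x sub show "x \<in> vs.span (insert a B)" using vs.span_base by blast
      next
        fix x assume x: "x \<in> insert a B"
        have sub: "vs.span E \<subseteq> vs.span (insert e E)" by (rule vs.span_mono) auto
        have "a = smul H (1 / c) e + p" using c(1) by (simp add: e_def)
        also have "\<dots> \<in> vs.span (insert e E)"
          by (intro vs.span_add vs.span_scale) (use vs.span_base sub p in auto)
        finally have "a \<in> vs.span (insert e E)" .
        with x sub E(2) show "x \<in> vs.span (insert e E)" using vs.span_base by blast
      qed
      moreover have "\<forall>b\<in>insert e E. \<forall>d\<in>insert e E. ip H b d = (if b = d then 1 else 0)"
        using on e c(2) unfolding e_def[symmetric] by fastforce
      ultimately show ?thesis using E(1) by blast
    qed
  qed
  then show thesis using that by blast
qed

lemma orthonormal_basis_exists: "\<exists>B. orthonormal_basis H B"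
proof -
  from finite_dim obtain B where "finite B" "vs.span B = UNIV" by blast
  with orthonormal_span[of B] show ?thesis unfolding orthonormal_basis_def by metis
qed

lemma subspace_finite_span:
  assumes "vs.subspace U"
  obtains B where "finite B" and "vs.span B = U"
proof -
  from finite_dim obtain B where B: "finite B" "vs.span B = UNIV" by blast
  obtain C where C: "C \<subseteq> U" "vs.independent C" "U \<subseteq> vs.span C"
    using vs.maximal_independent_subset[of U] by blast
  have "finite C"
    using vs.independent_span_bound[OF B(1) C(2)] B(2) by auto
  moreover have "vs.span C = U"
    using C vs.span_minimal[OF C(1) assms] by auto
  ultimately show thesis using that by blast
qed

lemma orth_proj:
  assumes "vs.subspace U"
  shows "orth_proj H U x \<in> U" and "\<And>u. u \<in> U \<Longrightarrow> ip H (x - orth_proj H U x) u = 0"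
proof -
  obtain B where B: "finite B" "vs.span B = U" using subspace_finite_span[OF assms] .
  obtain E where E: "finite E" "vs.span E = U"
    and on: "\<forall>b\<in>E. \<forall>c\<in>E. ip H b c = (if b = c then 1 else 0)"
    using orthonormal_span[OF B(1)] B(2) by metis
  define p where "p = (\<Sum>e\<in>E. smul H (ip H x e) e)"
  have p: "p \<in> U"
    unfolding p_def E(2)[symmetric] by (intro vs.span_sum vs.span_scale vs.span_base)
  have "ip H (x - p) b = 0" if "b \<in> E" for b
  proof -
    have "ip H p b = (\<Sum>e\<in>E. if e = b then ip H x e else 0)"
      unfolding p_def ip_sum_left ip_smul_left using on that by (intro sum.cong) auto
    then show ?thesis using that E(1) by (simp add: ip_diff_left)
  qed
  then have orth: "\<forall>u\<in>U. ip H (x - p) u = 0" using orth_span E(2) by blast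
  have "q = p" if "q \<in> U" "\<forall>u\<in>U. ip H (x - q) u = 0" for q
  proof -
    have "q - p \<in> U" using vs.subspace_diff[OF assms that(1) p] .
    then have "ip H (q - p) (q - p) = ip H (x - p) (q - p) - ip H (x - q) (q - p)"
      by (simp add: ip_diff_left[symmetric])
    also have "\<dots> = 0" using orth that(2) \<open>q - p \<in> U\<close> by simp
    finally show ?thesis by (simp add: ip_eq_0_iff)
  qed
  then have uniq: "\<And>q. q \<in> U \<and> (\<forall>u\<in>U. ip H (x - q) u = 0) \<Longrightarrow> q = p" by blast
  have "orth_proj H U x \<in> U \<and> (\<forall>u\<in>U. ip H (x - orth_proj H U x) u = 0)"
    unfolding orth_proj_def
    by (rule theI[where P = "\<lambda>q. q \<in> U \<and> (\<forall>u\<in>U. ip H (x - q) u = 0)"])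
      (use p orth uniq in blast)+
  then show "orth_proj H U x \<in> U" and "\<And>u. u \<in> U \<Longrightarrow> ip H (x - orth_proj H U x) u = 0"
    by blast+
qed

lemma analysis_in_direct_sum:
  assumes "bessel_fusion_sequence H W w"
  shows "analysis H W w x \<in> direct_sum W"
  using assms orth_proj(1) vs.subspace_scale
  unfolding bessel_fusion_sequence_def direct_sum_def analysis_def by blast

lemma analysis_adjoint:
  assumes "bessel_fusion_sequence H W w" and f: "f \<in> direct_sum W"
  shows "ip H (synthesis H w f) x = direct_sum_ip H f (analysis H W w x)"
proof -
  have "ip H (f i) x = ip H (f i) (orth_proj H (W i) x)" for i
  proof -
    have "ip H (x - orth_proj H (W i) x) (f i) = 0"
      using assms orth_proj(2) unfolding bessel_fusion_sequence_def direct_sum_def by blast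
    then have "ip H (f i) (x - orth_proj H (W i) x) = 0" by (simp add: ip_eq_0_commute)
    then show ?thesis
      using ip_add_right[of "f i" "x - orth_proj H (W i) x" "orth_proj H (W i) x"] by simp
  qed
  then show ?thesis
    unfolding synthesis_def direct_sum_ip_def analysis_def
    by (simp add: ip_sum_left ip_smul_left ip_smul_right)
qed

lemma orthonormal_basis_expansion:
  assumes "orthonormal_basis H B"
  shows "x = (\<Sum>b\<in>B. smul H (ip H x b) b)"
proof -
  have B: "finite B" "vs.span B = UNIV"
    and on: "\<And>b c. b \<in> B \<Longrightarrow> c \<in> B \<Longrightarrow> ip H b c = (if b = c then 1 else 0)"
    using assms unfolding orthonormal_basis_def by auto
  let ?y = "x - (\<Sum>b\<in>B. smul H (ip H x b) b)"
  have "ip H ?y c = 0" if "c \<in> B" for c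
  proof -
    have "(\<Sum>b\<in>B. ip H x b * ip H b c) = (\<Sum>b\<in>B. if b = c then ip H x b else 0)"
      using on that by (intro sum.cong) auto
    then show ?thesis using that B(1) by (simp add: ip_diff_left ip_sum_left ip_smul_left)
  qed
  then have "ip H ?y ?y = 0" using orth_span[of B ?y ?y] B(2) by auto
  then show ?thesis by (simp add: ip_eq_0_iff)
qed

lemma frob_sum_basis_independent:
  assumes "orthonormal_basis H B" and C: "orthonormal_basis H C" and "linear_op H A"
  shows "(\<Sum>b\<in>B. ip H (A b) (A b)) = (\<Sum>c\<in>C. ip H (A c) (A c))"
proof -
  interpret A: Vector_Spaces.linear "smul H" "smul H" A
    using assms(3) by (simp add: linear_op_def)
  have expand: "A x = (\<Sum>b\<in>B. smul H (ip H x b) (A b))"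
    if "orthonormal_basis H B" for x B
    using arg_cong[OF orthonormal_basis_expansion[OF that, of x], of A]
    by (simp add: A.sum A.scale)
  have swap: "(\<Sum>c\<in>C. ip H (A c) (A c)) = (\<Sum>b\<in>B. \<Sum>c\<in>C. ip H c b * ip H (A b) (A c))"
  proof -
    have "ip H (A c) (A c) = (\<Sum>b\<in>B. ip H c b * ip H (A b) (A c))" for c
      by (subst (1) expand[OF assms(1), of c]) (simp add: ip_sum_left ip_smul_left)
    then show ?thesis by (simp add: sum.swap[of _ B C])
  qed
  have inner: "(\<Sum>c\<in>C. ip H c b * ip H (A b) (A c)) = ip H (A b) (A b)" for b
  proof -
    have "ip H (A b) (A b) = (\<Sum>c\<in>C. ip H (A b) (smul H (ip H b c) (A c)))"
      by (subst (2) expand[OF C, of b]) (simp add: ip_sum_right)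
    also have "\<dots> = (\<Sum>c\<in>C. ip H c b * ip H (A b) (A c))"
    proof (rule sum.cong[OF refl])
      fix c
      have "to_complex (ip H (A b) (smul H (ip H b c) (A c)))
          = to_complex (ip H c b * ip H (A b) (A c))"
        by (simp add: ip_commute[of "A b"] ip_commute[of c b] ip_smul_left to_complex_mult)
      then show "ip H (A b) (smul H (ip H b c) (A c)) = ip H c b * ip H (A b) (A c)"
        by (simp only: to_complex_eq_iff)
    qed
    finally show ?thesis ..
  qed
  show ?thesis unfolding swap inner ..
qed

lemma to_complex_sum: "to_complex (\<Sum>i\<in>I. f i :: 'k) = (\<Sum>i\<in>I. to_complex (f i))"
  by (induction I rule: infinite_finite_induct) (auto simp: to_complex_add)

lemma frob_norm_eq:
  assumes "orthonormal_basis H B" and "linear_op H A"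
  shows "frob_norm H A = sqrt (\<Sum>b\<in>B. (hnorm H (A b))\<^sup>2)"
proof -
  have "orthonormal_basis H (SOME B. orthonormal_basis H B)"
    using someI_ex[OF orthonormal_basis_exists] .
  from frob_sum_basis_independent[OF this assms]
  have *: "(\<Sum>b\<in>(SOME B. orthonormal_basis H B). Re (to_complex (ip H (A b) (A b))))
      = (\<Sum>b\<in>B. Re (to_complex (ip H (A b) (A b))))"
    by (metis (mono_tags) to_complex_sum Re_sum)
  have "(hnorm H y)\<^sup>2 = Re (to_complex (ip H y y))" for y
    using ip_pos[of y] by (cases "y = 0") (auto simp: hnorm_def)
  then show ?thesis unfolding frob_norm_def by (simp add: *)
qed

end

end

theory Submission
  imports Defs
begin

text \<open>
  The factor \<open>1 / (w i * v i)\<close> cancels all weights, so \<open>S\<^sub>D\<close> is just the sum \<open>\<Sum>\<^sub>i \<pi>\<^sub>i\<close> of the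
  projections onto the \<open>W\<^sub>i\<close>. The losses of a dual pair depend only on the operators
  \<open>B\<^sub>i = T Q M\<^sub>i T\<^sup>*\<close>, which satisfy \<open>B\<^sub>i \<pi>\<^sub>i = B\<^sub>i\<close> and \<open>\<Sum>\<^sub>i B\<^sub>i = I\<close>. Put \<open>C\<^sub>i = B\<^sub>i - S\<^sub>D\<^sup>-\<^sup>1 \<pi>\<^sub>i\<close>. Then
  \<open>\<Sum>\<^sub>i \<langle>C\<^sub>i, S\<^sub>D\<^sup>-\<^sup>1 \<pi>\<^sub>i\<rangle> = \<Sum>\<^sub>i \<langle>C\<^sub>i \<pi>\<^sub>i, S\<^sub>D\<^sup>-\<^sup>1\<rangle> = \<langle>\<Sum>\<^sub>i C\<^sub>i, S\<^sub>D\<^sup>-\<^sup>1\<rangle> = 0\<close> for the Frobenius inner product, so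
  by Pythagoras the one-erasure loss has the unique minimizer \<open>B\<^sub>i = S\<^sub>D\<^sup>-\<^sup>1 \<pi>\<^sub>i\<close>. All minimizers
  therefore agree in every further loss, and the later stages discard nothing.
\<close>

section \<open>Losses in the 2-norm as Frobenius norms of erasure operators\<close>

lemma p_norm_2: "p_norm 2 I x = sqrt (\<Sum>i\<in>I. (x i)\<^sup>2)"
  by (simp add: p_norm_def numeral_eq_enat sqrt_def)

text \<open>Losses see a dual pair only through these operators; for \<open>J = {i}\<close> this is
  \<open>B\<^sub>i\<close> from above.\<close>

definition erasure_op ::
  "('k::real_or_complex, 'h::ab_group_add) hilbert_space \<Rightarrow> ('m::finite \<Rightarrow> 'h set) \<Rightarrow> ('m \<Rightarrow> real) \<Rightarrow>
     ('m \<Rightarrow> 'h set) \<times> ('m \<Rightarrow> real) \<times> (('m \<Rightarrow> 'h) \<Rightarrow> ('m \<Rightarrow> 'h)) \<Rightarrow> 'm set \<Rightarrow> 'h \<Rightarrow> 'h" where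
  "erasure_op H W w = (\<lambda>(V, v, Q) J x. synthesis H v (Q (keep J (analysis H W w x))))"

lemma loss_eq: "loss H W w d J = frob_norm H (erasure_op H W w d J)"
  by (cases d) (simp add: loss_def erasure_op_def)

lemma loss_norm_2_1:
  fixes W :: "'m::finite \<Rightarrow> 'h::ab_group_add set"
  shows "loss_norm H 2 (Suc 0) W w d = sqrt (\<Sum>i\<in>UNIV. (frob_norm H (erasure_op H W w d {i}))\<^sup>2)"
proof -
  have "{J::'m set. card J = Suc 0} = range (\<lambda>i. {i})"
    by (auto simp: card_1_singleton_iff)
  then show ?thesis
    by (simp add: loss_norm_def p_norm_2 loss_eq sum.reindex)
qed

lemma keep_UNIV [simp]: "keep UNIV f = f"
  by (simp add: keep_def)

context fd_hilbert
begin

interpretation vs: vector_space "smul H" by (rule vector_space_smul)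

section \<open>Norms and the Frobenius inner product\<close>

lemma hnorm_sq: "(hnorm H x)\<^sup>2 = Re (to_complex (ip H x x))"
  using ip_pos[of x] by (cases "x = 0") (auto simp: hnorm_def)

lemma hnorm_eq_0_iff: "hnorm H x = 0 \<longleftrightarrow> x = 0"
  using ip_pos[of x] by (cases "x = 0") (auto simp: hnorm_def)

lemma hnorm_sq_add:
  "(hnorm H (x + y))\<^sup>2 = (hnorm H x)\<^sup>2 + (hnorm H y)\<^sup>2 + 2 * Re (to_complex (ip H x y))"
proof -
  have "Re (to_complex (ip H y x)) = Re (to_complex (ip H x y))"
    by (simp add: ip_commute[of y x])
  then show ?thesis
    by (simp add: hnorm_sq ip_add_left ip_add_right to_complex_add)
qed

text \<open>Cyclicity of the trace: the two sides are \<open>tr (P Y\<^sup>* X)\<close> and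
  \<open>tr (Y\<^sup>* X P)\<close>. Expanding \<open>P b\<close> in the basis turns both into one
  double sum. In this way projections will be moved across the Frobenius inner product.\<close>

lemma frob_sum_swap_selfadjoint:
  assumes B: "orthonormal_basis H B"
    and X: "linear_op H X" and Y: "linear_op H Y" and P: "selfadjoint H P"
  shows "(\<Sum>b\<in>B. ip H (X b) (Y (P b))) = (\<Sum>b\<in>B. ip H (X (P b)) (Y b))"
proof -
  interpret X: Vector_Spaces.linear "smul H" "smul H" X using X by (simp add: linear_op_def)
  interpret Y: Vector_Spaces.linear "smul H" "smul H" Y using Y by (simp add: linear_op_def)
  have XP: "ip H (X (P c)) z = (\<Sum>b\<in>B. ip H (P c) b * ip H (X b) z)" for c z
    by (subst orthonormal_basis_expansion[OF B, of "P c"])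
      (simp add: X.sum X.scale ip_sum_left ip_smul_left)
  have YP: "ip H z (Y (P b)) = (\<Sum>c\<in>B. ip H c (P b) * ip H z (Y c))" for b z
  proof -
    have "ip H z (Y (P b)) = (\<Sum>c\<in>B. ip H z (smul H (ip H (P b) c) (Y c)))"
      by (subst orthonormal_basis_expansion[OF B, of "P b"])
        (simp add: Y.sum Y.scale ip_sum_right)
    also have "\<dots> = (\<Sum>c\<in>B. ip H c (P b) * ip H z (Y c))"
    proof (rule sum.cong[OF refl])
      fix c
      \<comment> \<open>Conjugation of scalars is available only after \<open>to_complex\<close>, so
        conjugate-linearity in the second argument is checked there.\<close>
      have "to_complex (ip H z (smul H (ip H (P b) c) (Y c)))
          = to_complex (ip H c (P b) * ip H z (Y c))"
        by (simp add: ip_commute[of z] ip_commute[of c "P b"] ip_smul_left to_complex_mult)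
      then show "ip H z (smul H (ip H (P b) c) (Y c)) = ip H c (P b) * ip H z (Y c)"
        by (simp only: to_complex_eq_iff)
    qed
    finally show ?thesis .
  qed
  have "(\<Sum>b\<in>B. ip H (X b) (Y (P b))) = (\<Sum>b\<in>B. \<Sum>c\<in>B. ip H (P c) b * ip H (X b) (Y c))"
    using P by (simp add: YP selfadjoint_def)
  also have "\<dots> = (\<Sum>b\<in>B. ip H (X (P b)) (Y b))"
    by (subst sum.swap) (simp add: XP)
  finally show ?thesis .
qed

text \<open>Names the very basis that \<open>frob_norm\<close> chooses, so that all squared norms
  become sums over one common basis.\<close>

definition std_basis :: "'h set" where
  "std_basis = (SOME B. orthonormal_basis H B)"

lemma std_basis: "orthonormal_basis H std_basis"
  unfolding std_basis_def using someI_ex[OF orthonormal_basis_exists] .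

lemma frob_norm_sq: "(frob_norm H A)\<^sup>2 = (\<Sum>b\<in>std_basis. (hnorm H (A b))\<^sup>2)"
  by (simp add: frob_norm_def std_basis_def sum_nonneg)

lemma frob_norm_eq_0D:
  assumes "linear_op H A" and "frob_norm H A = 0"
  shows "A x = 0"
proof -
  interpret A: Vector_Spaces.linear "smul H" "smul H" A
    using assms(1) by (simp add: linear_op_def)
  have "finite std_basis" using std_basis by (simp add: orthonormal_basis_def)
  then have "A b = 0" if "b \<in> std_basis" for b
    using assms(2) that frob_norm_sq[of A] by (simp add: sum_nonneg_eq_0_iff hnorm_eq_0_iff)
  then show ?thesis
    by (subst orthonormal_basis_expansion[OF std_basis, of x]) (simp add: A.sum A.scale)
qed

lemma linear_opI:
  assumes "\<And>x y. A (x + y) = A x + A y" and "\<And>c x. A (smul H c x) = smul H c (A x)"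
  shows "linear_op H A"
  unfolding linear_op_def
  using assms vector_space_smul by (intro Vector_Spaces.linear.intro module_hom.intro
      module_hom_axioms.intro) (auto simp: vector_space_def module_def)

section \<open>Orthogonal projections and selfadjoint operators\<close>

lemma orth_proj_unique:
  assumes U: "vs.subspace U" and "p \<in> U" and "\<And>u. u \<in> U \<Longrightarrow> ip H (x - p) u = 0"
  shows "orth_proj H U x = p"
proof -
  let ?q = "orth_proj H U x"
  have "?q - p \<in> U" using vs.subspace_diff[OF U orth_proj(1)[OF U] assms(2)] .
  then have "ip H (?q - p) (?q - p) = ip H (x - p) (?q - p) - ip H (x - ?q) (?q - p)"
    by (simp add: ip_diff_left[symmetric])
  also have "\<dots> = 0" using assms(3) orth_proj(2)[OF U] \<open>?q - p \<in> U\<close> by simp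
  finally show ?thesis by (simp add: ip_eq_0_iff)
qed

lemma orth_proj_fixes: "vs.subspace U \<Longrightarrow> x \<in> U \<Longrightarrow> orth_proj H U x = x"
  by (rule orth_proj_unique) auto

lemma orth_proj_add:
  assumes U: "vs.subspace U"
  shows "orth_proj H U (x + y) = orth_proj H U x + orth_proj H U y"
  by (rule orth_proj_unique[OF U vs.subspace_add[OF U orth_proj(1)[OF U] orth_proj(1)[OF U]]])
    (simp add: add_diff_add ip_add_left orth_proj(2)[OF U])

lemma orth_proj_scale:
  assumes U: "vs.subspace U"
  shows "orth_proj H U (smul H c x) = smul H c (orth_proj H U x)"
  by (rule orth_proj_unique[OF U vs.subspace_scale[OF U orth_proj(1)[OF U]]])
    (simp add: vs.scale_right_diff_distrib[symmetric] ip_smul_left orth_proj(2)[OF U])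

lemma ip_orth_proj:
  assumes U: "vs.subspace U"
  shows "ip H (orth_proj H U x) y = ip H (orth_proj H U x) (orth_proj H U y)"
proof -
  have "ip H (orth_proj H U x) (y - orth_proj H U y) = 0"
    using orth_proj[OF U] ip_eq_0_commute by blast
  then show ?thesis
    using ip_add_right[of "orth_proj H U x" "y - orth_proj H U y" "orth_proj H U y"] by simp
qed

lemma selfadjoint_orth_proj:
  assumes U: "vs.subspace U"
  shows "selfadjoint H (orth_proj H U)"
  unfolding selfadjoint_def
proof (intro allI)
  fix x y
  have "to_complex (ip H x (orth_proj H U y))
      = to_complex (ip H (orth_proj H U x) (orth_proj H U y))"
    by (simp only: ip_commute[of x] ip_commute[of "orth_proj H U x"]
        ip_orth_proj[OF U, of y x])
  then show "ip H (orth_proj H U x) y = ip H x (orth_proj H U y)"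
    by (simp add: to_complex_eq_iff ip_orth_proj[OF U, of x y])
qed

text \<open>The residual \<open>z\<close> of projecting \<open>y\<close> onto \<open>range A\<close>
  is orthogonal to the range. Hence \<open>ip H (A z) (A z) = ip H z (A (A z)) = 0\<close>, and the
  trivial kernel forces \<open>z = 0\<close>.\<close>

lemma surj_selfadjoint:
  assumes A: "linear_op H A" and sa: "selfadjoint H A" and ker: "\<And>x. A x = 0 \<Longrightarrow> x = 0"
  shows "surj A"
proof -
  interpret A: Vector_Spaces.linear "smul H" "smul H" A using A by (simp add: linear_op_def)
  have R: "vs.subspace (range A)" by (rule A.subspace_image[OF vs.subspace_UNIV])
  have "y \<in> range A" for y
  proof -
    let ?z = "y - orth_proj H (range A) y"
    have "ip H (A ?z) (A ?z) = ip H ?z (A (A ?z))"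
      using sa by (simp add: selfadjoint_def)
    also have "\<dots> = 0" by (rule orth_proj(2)[OF R]) simp
    finally have "A ?z = 0" by (simp only: ip_eq_0_iff)
    then have "?z = 0" by (rule ker)
    then show ?thesis using orth_proj(1)[OF R, of y] by simp
  qed
  then show ?thesis by auto
qed

lemma linear_op_inv:
  assumes A: "linear_op H A" and "bij A"
  shows "linear_op H (inv A)"
proof (rule linear_opI)
  interpret A: Vector_Spaces.linear "smul H" "smul H" A using A by (simp add: linear_op_def)
  have [simp]: "A (inv A y) = y" for y
    using assms(2) by (simp add: bij_is_surj surj_f_inv_f)
  have inj: "inj A" using assms(2) by (rule bij_is_inj)
  show "inv A (x + y) = inv A x + inv A y" for x y
    by (rule inv_f_eq[OF inj]) (simp add: A.add)
  show "inv A (smul H c x) = smul H c (inv A x)" for c x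
    by (rule inv_f_eq[OF inj]) (simp add: A.scale)
qed

section \<open>Synthesis and linear maps on direct sums\<close>

lemma synthesis_add: "synthesis H u (\<lambda>i. f i + g i) = synthesis H u f + synthesis H u g"
  by (simp add: synthesis_def vs.scale_right_distrib sum.distrib)

lemma synthesis_scale: "synthesis H u (\<lambda>i. smul H c (f i)) = smul H c (synthesis H u f)"
  by (simp add: synthesis_def vs.scale_sum_right mult.commute)

lemma synthesis_keep: "synthesis H u (keep {i} f) = smul H (of_real (u i)) (f i)"
proof -
  have "synthesis H u (keep {i} f) = (\<Sum>k\<in>UNIV. if k = i then smul H (of_real (u k)) (f k) else 0)"
    unfolding synthesis_def by (rule sum.cong) (auto simp: keep_def)
  then show ?thesis by simp
qed

lemma keep_in_direct_sum:
  "\<forall>i. vs.subspace (W i) \<Longrightarrow> f \<in> direct_sum W \<Longrightarrow> keep J f \<in> direct_sum W"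
  by (auto simp: direct_sum_def keep_def vs.subspace_0)

text \<open>A vector of \<open>W i\<close> extends by zeros to the direct sum, since every
  \<open>W k\<close> contains 0.\<close>

lemma component_direct_sum:
  assumes "\<forall>i. vs.subspace (W i)"
  shows "(\<lambda>f. f i) ` direct_sum W = W i"
proof (intro equalityI subsetI)
  fix x assume "x \<in> W i"
  then have "keep {i} (\<lambda>_. x) \<in> direct_sum W"
    using assms by (auto simp: direct_sum_def keep_def vs.subspace_0)
  moreover have "x = keep {i} (\<lambda>_. x) i" by (simp add: keep_def)
  ultimately show "x \<in> (\<lambda>f. f i) ` direct_sum W" by blast
qed (auto simp: direct_sum_def)

lemma direct_sum_linear_0:
  assumes "\<forall>i. vs.subspace (W i)" and "direct_sum_linear H W V Q"
  shows "Q (\<lambda>i. 0) = (\<lambda>i. 0)"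
proof -
  have "Q (\<lambda>i. smul H c (f i)) = (\<lambda>i. smul H c (Q f i))" if "f \<in> direct_sum W" for c f
    using assms(2) that by (simp add: direct_sum_linear_def)
  \<comment> \<open>Homogeneity with scalar 0, applied to the zero family.\<close>
  from this[of "\<lambda>i. 0" 0] show ?thesis
    using assms(1) by (simp add: direct_sum_def vs.subspace_0)
qed

text \<open>Additivity of \<open>Q\<close> is assumed only on \<open>direct_sum W\<close>, so
  components are split off one at a time, with all partial families staying in the direct
  sum.\<close>

lemma direct_sum_linear_keep:
  assumes W: "\<forall>i. vs.subspace (W i)" and Q: "direct_sum_linear H W V Q"
    and f: "f \<in> direct_sum W" and "finite J"
  shows "Q (keep J f) = (\<lambda>k. \<Sum>i\<in>J. Q (keep {i} f) k)"
  using \<open>finite J\<close>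
proof (induction J rule: finite_induct)
  case empty
  then show ?case using direct_sum_linear_0[OF W Q] by (simp add: keep_def)
next
  case (insert j J)
  have "keep (insert j J) f = (\<lambda>i. keep {j} f i + keep J f i)"
    using insert.hyps by (auto simp: keep_def)
  moreover have "Q (\<lambda>i. keep {j} f i + keep J f i) = (\<lambda>i. Q (keep {j} f) i + Q (keep J f) i)"
    using Q keep_in_direct_sum[OF W f] unfolding direct_sum_linear_def by blast
  ultimately show ?case using insert by simp
qed

lemma synthesis_keep_sum:
  assumes W: "\<forall>i. vs.subspace (W i)" and Q: "direct_sum_linear H W V Q"
    and f: "f \<in> direct_sum W"
  shows "synthesis H u (Q (keep J f)) = (\<Sum>i\<in>J. synthesis H u (Q (keep {i} f)))"
  unfolding synthesis_def direct_sum_linear_keep[OF W Q f finite[of J]]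
  by (simp add: vs.scale_sum_right sum.swap[of _ UNIV])

end

section \<open>The operator \<open>S_D\<close> and its inverse\<close>

locale weighted_fusion_frame = fd_hilbert H
  for H :: "('k::real_or_complex, 'h::ab_group_add) hilbert_space" +
  fixes W :: "'m::finite \<Rightarrow> 'h set" and w v :: "'m \<Rightarrow> real"
  assumes frame: "fusion_frame H W w" and v_pos: "v i > 0"
begin

interpretation vs: vector_space "smul H" by (rule vector_space_smul)

abbreviation proj :: "'m \<Rightarrow> 'h \<Rightarrow> 'h" where "proj i \<equiv> orth_proj H (W i)"
abbreviation S :: "'h \<Rightarrow> 'h" where "S \<equiv> S_D H W w v"
abbreviation opt_dual where "opt_dual \<equiv> (\<lambda>i. inv S ` W i, v, Q_D H W w v)"

lemma bessel: "bessel_fusion_sequence H W w"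
  using frame by (simp add: fusion_frame_def)

lemma subspaces: "\<forall>i. vs.subspace (W i)"
  using bessel by (simp add: bessel_fusion_sequence_def)

lemma subspace: "vs.subspace (W i)"
  using subspaces by blast

lemma w_pos: "w i > 0"
  using bessel by (simp add: bessel_fusion_sequence_def)

lemma w_nonzero [simp]: "w i \<noteq> 0" and v_nonzero [simp]: "v i \<noteq> 0"
  using w_pos[of i] v_pos[of i] by auto

lemma S_eq: "S x = (\<Sum>i\<in>UNIV. proj i x)"
  unfolding S_D_def synthesis_def D_op_def analysis_def
  by (simp add: of_real_mult[symmetric] del: of_real_mult of_real_divide)

lemma linear_S: "linear_op H S"
  by (rule linear_opI)
    (simp_all add: S_eq orth_proj_add orth_proj_scale subspace sum.distrib vs.scale_sum_right)

lemma selfadjoint_S: "selfadjoint H S"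
  using selfadjoint_orth_proj[OF subspace]
  unfolding selfadjoint_def S_eq ip_sum_left ip_sum_right by simp

lemma ip_S: "to_complex (ip H (S x) x) = of_real (\<Sum>i\<in>UNIV. (hnorm H (proj i x))\<^sup>2)"
proof -
  \<comment> \<open>\<open>ip H y y\<close> equals its own conjugate, hence is real.\<close>
  have "to_complex (ip H y y) = of_real ((hnorm H y)\<^sup>2)" for y
    using ip_commute[of y y] by (simp add: hnorm_sq complex_eq_iff del: of_real_power)
  then have "to_complex (ip H (proj i x) x) = of_real ((hnorm H (proj i x))\<^sup>2)" for i
    by (simp only: ip_orth_proj[OF subspace, of i x x])
  then show ?thesis by (simp add: S_eq ip_sum_left to_complex_sum)
qed

lemma positive_S: "positive_op H S"
  unfolding positive_op_def ip_S
  by (simp add: nonneg_Reals_of_real_iff sum_nonneg del: of_real_sum of_real_power)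

text \<open>By \<open>ip_S\<close> every \<open>proj i x\<close> vanishes, so \<open>x\<close> is
  orthogonal to all \<open>W i\<close> and hence to their span, which is the whole space.\<close>

lemma S_eq_0D:
  assumes "S x = 0" shows "x = 0"
proof -
  have "complex_of_real (\<Sum>i\<in>UNIV. (hnorm H (proj i x))\<^sup>2) = 0"
    using ip_S[of x] assms by simp
  then have "(\<Sum>i\<in>UNIV. (hnorm H (proj i x))\<^sup>2) = 0" by (simp only: of_real_eq_0_iff)
  then have "proj i x = 0" for i by (simp add: sum_nonneg_eq_0_iff hnorm_eq_0_iff)
  then have "ip H x u = 0" if "u \<in> W i" for u i
    using orth_proj(2)[OF subspace that, of x] by simp
  then have "ip H x x = 0"
    using orth_span[of "\<Union>i. W i" x x] frame by (auto simp: fusion_frame_def)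
  then show ?thesis by (simp add: ip_eq_0_iff)
qed

lemma bij_S: "bij S"
proof -
  interpret S: Vector_Spaces.linear "smul H" "smul H" S using linear_S by (simp add: linear_op_def)
  have "inj S" unfolding S.inj_iff_eq_0 using S_eq_0D by blast
  then show ?thesis
    using surj_selfadjoint[OF linear_S selfadjoint_S S_eq_0D] by (simp add: bij_def)
qed

lemma S_inv [simp]: "S (inv S x) = x" and inv_S [simp]: "inv S (S x) = x"
  using bij_S by (simp_all add: bij_is_surj surj_f_inv_f bij_is_inj)

lemma linear_inv_S: "linear_op H (inv S)"
  by (rule linear_op_inv[OF linear_S bij_S])

sublocale inv_S: Vector_Spaces.linear "smul H" "smul H" "inv S"
  using linear_inv_S by (simp add: linear_op_def)

section \<open>Erasure operators of an arbitrary dual pair\<close>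

lemma linear_erasure_op:
  assumes "dual_fusion_frame H W w V u Q"
  shows "linear_op H (erasure_op H W w (V, u, Q) J)"
proof (rule linear_opI)
  have Q: "direct_sum_linear H W V Q" using assms by (simp add: dual_fusion_frame_def)
  let ?T = "\<lambda>x. keep J (analysis H W w x)"
  have T: "?T x \<in> direct_sum W" for x
    by (rule keep_in_direct_sum[OF subspaces analysis_in_direct_sum[OF bessel]])
  show "erasure_op H W w (V, u, Q) J (x + y)
      = erasure_op H W w (V, u, Q) J x + erasure_op H W w (V, u, Q) J y" for x y
  proof -
    have "?T (x + y) = (\<lambda>i. ?T x i + ?T y i)"
      by (auto simp: keep_def analysis_def orth_proj_add subspace vs.scale_right_distrib)
    then have "Q (?T (x + y)) = (\<lambda>i. Q (?T x) i + Q (?T y) i)"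
      using Q T unfolding direct_sum_linear_def by metis
    then show ?thesis by (simp add: erasure_op_def synthesis_add)
  qed
  show "erasure_op H W w (V, u, Q) J (smul H c x) = smul H c (erasure_op H W w (V, u, Q) J x)" for c x
  proof -
    have "?T (smul H c x) = (\<lambda>i. smul H c (?T x i))"
      by (auto simp: keep_def analysis_def orth_proj_scale subspace mult.commute)
    then have "Q (?T (smul H c x)) = (\<lambda>i. smul H c (Q (?T x) i))"
      using Q T unfolding direct_sum_linear_def by metis
    then show ?thesis by (simp add: erasure_op_def synthesis_scale)
  qed
qed

text \<open>This is why single erasures decide all losses: the operators for larger \<open>J\<close>
  are determined by those for singletons.\<close>

lemma erasure_op_sum:
  assumes "dual_fusion_frame H W w V u Q"
  shows "erasure_op H W w (V, u, Q) J x = (\<Sum>i\<in>J. erasure_op H W w (V, u, Q) {i} x)"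
  using assms synthesis_keep_sum[OF subspaces _ analysis_in_direct_sum[OF bessel], of V Q u J x]
  by (simp add: erasure_op_def dual_fusion_frame_def)

lemma erasure_op_UNIV:
  "dual_fusion_frame H W w V u Q \<Longrightarrow> erasure_op H W w (V, u, Q) UNIV x = x"
  by (simp add: erasure_op_def dual_fusion_frame_def)

text \<open>Only component \<open>i\<close> survives \<open>keep {i}\<close>, and
  \<open>proj i\<close> is idempotent.\<close>

lemma erasure_op_proj: "erasure_op H W w d {i} (proj i x) = erasure_op H W w d {i} x"
proof -
  have "keep {i} (analysis H W w (proj i x)) = keep {i} (analysis H W w x)"
    by (auto simp: keep_def analysis_def orth_proj_fixes subspace orth_proj(1))
  then show ?thesis by (cases d) (simp add: erasure_op_def)
qed

text \<open>With \<open>A = B\<^sub>i\<close> these maps are the deviations \<open>C\<^sub>i\<close>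
  from the optimal operators.\<close>

lemma linear_op_diff_inv_S_proj:
  assumes "linear_op H A"
  shows "linear_op H (\<lambda>x. A x - inv S (proj i x))"
proof (rule linear_opI)
  interpret A: Vector_Spaces.linear "smul H" "smul H" A
    using assms by (simp add: linear_op_def)
  show "A (x + y) - inv S (proj i (x + y)) = A x - inv S (proj i x) + (A y - inv S (proj i y))" for x y
    by (simp add: A.add inv_S.add orth_proj_add subspace)
  show "A (smul H c x) - inv S (proj i (smul H c x)) = smul H c (A x - inv S (proj i x))" for c x
    by (simp add: A.scale inv_S.scale orth_proj_scale subspace vs.scale_right_diff_distrib)
qed

text \<open>The Pythagorean identity behind optimality. The three assumptions are properties that
  the erasure operators of every dual pair have.\<close>

lemma frob_norm_decomposition:
  assumes lin: "\<And>i. linear_op H (B i)" and proj: "\<And>i x. B i (proj i x) = B i x"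
    and sum: "\<And>x. (\<Sum>i\<in>UNIV. B i x) = x"
  shows "(\<Sum>i\<in>UNIV. (frob_norm H (B i))\<^sup>2) =
    (\<Sum>i\<in>UNIV. (frob_norm H (\<lambda>x. inv S (proj i x)))\<^sup>2) +
    (\<Sum>i\<in>UNIV. (frob_norm H (\<lambda>x. B i x - inv S (proj i x)))\<^sup>2)"
proof -
  define C where "C i x = B i x - inv S (proj i x)" for i x
  \<comment> \<open>The \<open>B i\<close> sum to the identity, and so do the
    \<open>inv S (proj i x)\<close>, because \<open>S\<close> is the sum of the projections.\<close>
  have C_sum: "(\<Sum>i\<in>UNIV. C i x) = 0" for x
    by (simp add: C_def sum_subtractf sum flip: inv_S.sum S_eq)
  have linC: "linear_op H (C i)" for i
    unfolding C_def by (rule linear_op_diff_inv_S_proj[OF lin])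
  have C_proj: "C i (proj i x) = C i x" for i x
    by (simp add: C_def proj orth_proj_fixes subspace orth_proj(1))
  \<comment> \<open>\<open>proj i\<close> moves from the right factor to the left one, where
    \<open>C i\<close> absorbs it.\<close>
  have "(\<Sum>i\<in>UNIV. \<Sum>b\<in>std_basis. ip H (C i b) (inv S (proj i b)))
      = (\<Sum>i\<in>UNIV. \<Sum>b\<in>std_basis. ip H (C i b) (inv S b))"
    by (simp add: frob_sum_swap_selfadjoint[OF std_basis linC linear_inv_S
          selfadjoint_orth_proj[OF subspace]] C_proj)
  also have "\<dots> = (\<Sum>b\<in>std_basis. ip H (\<Sum>i\<in>UNIV. C i b) (inv S b))"
    by (subst sum.swap) (simp add: ip_sum_left)
  also have "\<dots> = 0" by (simp add: C_sum)
  finally have "to_complex (\<Sum>i\<in>UNIV. \<Sum>b\<in>std_basis. ip H (C i b) (inv S (proj i b))) = 0"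
    by simp
  \<comment> \<open>Only the real part of the inner product enters the expansion
    \<open>hnorm_sq_add\<close>.\<close>
  then have "Re (\<Sum>i\<in>UNIV. \<Sum>b\<in>std_basis. to_complex (ip H (C i b) (inv S (proj i b)))) = 0"
    by (simp only: to_complex_sum zero_complex.sel)
  then have orth: "(\<Sum>i\<in>UNIV. \<Sum>b\<in>std_basis. Re (to_complex (ip H (C i b) (inv S (proj i b))))) = 0"
    by simp
  have "(hnorm H (B i b))\<^sup>2 = (hnorm H (C i b))\<^sup>2 + (hnorm H (inv S (proj i b)))\<^sup>2
      + 2 * Re (to_complex (ip H (C i b) (inv S (proj i b))))" for i b
    using hnorm_sq_add[of "C i b" "inv S (proj i b)"] by (simp add: C_def)
  then have "(\<Sum>i\<in>UNIV. (frob_norm H (B i))\<^sup>2) = (\<Sum>i\<in>UNIV. (frob_norm H (C i))\<^sup>2)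
      + (\<Sum>i\<in>UNIV. (frob_norm H (\<lambda>x. inv S (proj i x)))\<^sup>2)
      + 2 * (\<Sum>i\<in>UNIV. \<Sum>b\<in>std_basis. Re (to_complex (ip H (C i b) (inv S (proj i b)))))"
    by (simp add: frob_norm_sq sum.distrib sum_distrib_left)
  then show ?thesis using orth by (simp add: C_def[abs_def])
qed

section \<open>The candidate pair is a component preserving dual\<close>

lemma Q_D_linear: "direct_sum_linear H W (\<lambda>i. inv S ` W i) (Q_D H W w v)"
  unfolding direct_sum_linear_def
proof (intro conjI ballI allI)
  fix f assume f: "f \<in> direct_sum W"
  have "Q_D H W w v f j = inv S (smul H (of_real (1 / (w j * v j))) (f j))" for j
    by (simp add: Q_D_def inv_S.scale)
  moreover have "smul H (of_real (1 / (w j * v j))) (f j) \<in> W j" for j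
    using f by (simp add: direct_sum_def vs.subspace_scale[OF subspace])
  ultimately show "Q_D H W w v f \<in> direct_sum (\<lambda>i. inv S ` W i)"
    by (auto simp: direct_sum_def)
next
  fix f g
  show "Q_D H W w v (\<lambda>i. f i + g i) = (\<lambda>i. Q_D H W w v f i + Q_D H W w v g i)"
    by (simp add: Q_D_def inv_S.add vs.scale_right_distrib)
next
  fix c f
  show "Q_D H W w v (\<lambda>i. smul H c (f i)) = (\<lambda>i. smul H c (Q_D H W w v f i))"
    by (simp add: Q_D_def inv_S.scale mult.commute)
qed

text \<open>The \<open>v i\<close> of the synthesis cancel those in \<open>Q_D\<close>; linearity
  then pulls \<open>inv S\<close> out of the sum.\<close>

lemma synthesis_Q_D:
  "synthesis H v (Q_D H W w v f) = inv S (\<Sum>i\<in>UNIV. smul H (of_real (1 / w i)) (f i))"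
proof -
  have "v i * (1 / (w i * v i)) = 1 / w i" for i by simp
  then show ?thesis
    unfolding synthesis_def Q_D_def vs.scale_scale of_real_mult[symmetric]
    by (simp add: inv_S.sum inv_S.scale)
qed

lemma erasure_op_opt_dual: "erasure_op H W w opt_dual {i} x = inv S (proj i x)"
proof -
  \<comment> \<open>A synthesis with weights \<open>1 / w k\<close> of a single component;
    \<open>1 / w i\<close> cancels the weight coming from \<open>analysis\<close>.\<close>
  have "(\<Sum>k\<in>UNIV. smul H (of_real (1 / w k)) (keep {i} (analysis H W w x) k)) = proj i x"
    using synthesis_keep[of "\<lambda>k. 1 / w k" i "analysis H W w x"]
    by (simp add: synthesis_def analysis_def of_real_mult[symmetric] del: of_real_mult of_real_divide)
  then show ?thesis by (simp add: erasure_op_def synthesis_Q_D)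
qed

lemma subspace_image: "vs.subspace (inv S ` W i)"
  by (rule inv_S.subspace_image[OF subspace])

lemma opt_dual: "dual_fusion_frame H W w (\<lambda>i. inv S ` W i) v (Q_D H W w v)"
proof -
  have "vs.span (\<Union>i. inv S ` W i) = inv S ` vs.span (\<Union>i. W i)"
    by (simp add: inv_S.span_image[symmetric] image_UN)
  also have "\<dots> = UNIV"
    using frame bij_imp_bij_inv[OF bij_S] by (simp add: fusion_frame_def bij_is_surj)
  finally have "fusion_frame H (\<lambda>i. inv S ` W i) v"
    using subspace_image v_pos by (simp add: fusion_frame_def bessel_fusion_sequence_def)
  moreover have "synthesis H v (Q_D H W w v (analysis H W w x)) = x" for x
  proof -
    have "(\<Sum>i\<in>UNIV. smul H (of_real (1 / w i)) (analysis H W w x i)) = S x"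
      by (simp add: S_eq analysis_def of_real_mult[symmetric] del: of_real_mult of_real_divide)
    then show ?thesis by (simp add: synthesis_Q_D)
  qed
  ultimately show ?thesis by (simp add: dual_fusion_frame_def Q_D_linear)
qed

lemma Q_D_component_preserving: "component_preserving W (\<lambda>i. inv S ` W i) (Q_D H W w v)"
  unfolding component_preserving_def
proof (intro allI equalityI subsetI)
  fix j g assume "g \<in> Q_D H W w v ` keep {j} ` direct_sum W"
  then obtain f where f: "f \<in> direct_sum W" and g: "g = Q_D H W w v (keep {j} f)" by blast
  have "g = keep {j} (Q_D H W w v f)"
    unfolding g by (auto simp: keep_def Q_D_def)
  then show "g \<in> keep {j} ` direct_sum (\<lambda>i. inv S ` W i)"
    using Q_D_linear f by (auto simp: direct_sum_linear_def)
next
  fix j g assume "g \<in> keep {j} ` direct_sum (\<lambda>i. inv S ` W i)"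
  then obtain h where h: "h \<in> direct_sum (\<lambda>i. inv S ` W i)" and g: "g = keep {j} h" by blast
  \<comment> \<open>The componentwise preimage of \<open>h\<close> under \<open>Q_D\<close>: undo
    \<open>inv S\<close> and the weights.\<close>
  define f where "f i = smul H (of_real (w i * v i)) (S (h i))" for i
  have "S (h i) \<in> W i" for i
  proof -
    have "h i \<in> inv S ` W i" using h by (simp add: direct_sum_def)
    then show ?thesis by auto
  qed
  then have "f \<in> direct_sum W"
    by (simp add: f_def direct_sum_def vs.subspace_scale[OF subspace])
  moreover have "g = Q_D H W w v (keep {j} f)"
    unfolding g by (auto simp: keep_def Q_D_def f_def inv_S.scale)
  ultimately show "g \<in> Q_D H W w v ` keep {j} ` direct_sum W" by blast
qed

section \<open>Minimality of the loss and the stages of optimal duals\<close>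

lemma loss_norm_min:
  assumes "dual_fusion_frame H W w V u Q"
  shows "loss_norm H 2 (Suc 0) W w opt_dual \<le> loss_norm H 2 (Suc 0) W w (V, u, Q)"
    and "loss_norm H 2 (Suc 0) W w (V, u, Q) = loss_norm H 2 (Suc 0) W w opt_dual \<Longrightarrow>
      erasure_op H W w (V, u, Q) {i} x = inv S (proj i x)"
proof -
  let ?B = "\<lambda>i. erasure_op H W w (V, u, Q) {i}"
  let ?C = "\<lambda>i x. ?B i x - inv S (proj i x)"
  have opt: "erasure_op H W w opt_dual {i} = (\<lambda>x. inv S (proj i x))" for i
    by (rule ext) (rule erasure_op_opt_dual)
  have lin: "linear_op H (?B i)" for i by (rule linear_erasure_op[OF assms])
  have "(\<Sum>i\<in>UNIV. ?B i x) = x" for x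
    using erasure_op_sum[OF assms, of UNIV x] erasure_op_UNIV[OF assms, of x] by simp
  from frob_norm_decomposition[of ?B, OF lin erasure_op_proj this]
  have *: "(\<Sum>i\<in>UNIV. (frob_norm H (?B i))\<^sup>2) =
    (\<Sum>i\<in>UNIV. (frob_norm H (\<lambda>x. inv S (proj i x)))\<^sup>2) + (\<Sum>i\<in>UNIV. (frob_norm H (?C i))\<^sup>2)" .
  then show "loss_norm H 2 (Suc 0) W w opt_dual \<le> loss_norm H 2 (Suc 0) W w (V, u, Q)"
    unfolding loss_norm_2_1 opt by (simp add: sum_nonneg)
  \<comment> \<open>In the equality case the nonnegative remainder is zero, so every deviation
    \<open>?C i\<close> vanishes.\<close>
  assume "loss_norm H 2 (Suc 0) W w (V, u, Q) = loss_norm H 2 (Suc 0) W w opt_dual"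
  with * have "(\<Sum>i\<in>UNIV. (frob_norm H (?C i))\<^sup>2) = 0"
    unfolding loss_norm_2_1 opt by simp
  then have "frob_norm H (?C i) = 0" by (simp add: sum_nonneg_eq_0_iff)
  moreover have "linear_op H (?C i)" by (rule linear_op_diff_inv_S_proj[OF lin])
  ultimately show "?B i x = inv S (proj i x)"
    using frob_norm_eq_0D by fastforce
qed

text \<open>Stage 1 is the equality case of \<open>loss_norm_min\<close>; later stages minimize a
  constant. The index is \<open>Suc r\<close> because stage 0 holds all dual pairs.\<close>

lemma optimal_duals_eq:
  "optimal_duals H 2 W w (Suc r) =
    {(V, u, Q). dual_fusion_frame H W w V u Q \<and>
       (\<forall>i x. erasure_op H W w (V, u, Q) {i} x = inv S (proj i x))}" (is "_ = ?X")
proof (induction r)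
  case 0
  \<comment> \<open>The infimum is attained at \<open>opt_dual\<close>.\<close>
  have "(INF d\<in>optimal_duals H 2 W w 0. loss_norm H 2 (Suc 0) W w d)
      = loss_norm H 2 (Suc 0) W w opt_dual"
    by (rule cInf_eq_minimum) (use opt_dual loss_norm_min(1) in auto)
  moreover have "loss_norm H 2 (Suc 0) W w (V, u, Q) = loss_norm H 2 (Suc 0) W w opt_dual"
    if "\<forall>i x. erasure_op H W w (V, u, Q) {i} x = inv S (proj i x)" for V u Q
  proof -
    have "erasure_op H W w (V, u, Q) {i} = erasure_op H W w opt_dual {i}" for i
      by (rule ext) (simp only: that erasure_op_opt_dual)
    then show ?thesis by (simp only: loss_norm_2_1)
  qed
  ultimately show ?case using loss_norm_min(2) by (auto simp del: One_nat_def)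
next
  case (Suc r)
  have const: "loss_norm H 2 n W w d = loss_norm H 2 n W w opt_dual" if "d \<in> ?X" for n d
  proof -
    obtain V u Q where d: "d = (V, u, Q)" by (cases d)
    \<comment> \<open>Agreement on singletons extends to every \<open>J\<close> by
      additivity.\<close>
    have "erasure_op H W w d J = erasure_op H W w opt_dual J" for J
      using that erasure_op_sum[of V u Q J] erasure_op_sum[OF opt_dual, of J]
      by (intro ext) (simp add: d erasure_op_opt_dual)
    then show ?thesis by (simp only: loss_norm_def loss_eq[abs_def])
  qed
  \<comment> \<open>Nonemptiness makes the infimum of a constant loss equal to that
    constant.\<close>
  have ne: "?X \<noteq> {}" using opt_dual erasure_op_opt_dual by blast
  have "(INF d\<in>?X. loss_norm H 2 (Suc (Suc r)) W w d) = loss_norm H 2 (Suc (Suc r)) W w opt_dual"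
    using const ne by (simp cong: INF_cong_simp)
  then have "\<forall>d\<in>?X. loss_norm H 2 (Suc (Suc r)) W w d
      = (INF d\<in>?X. loss_norm H 2 (Suc (Suc r)) W w d)"
    using const by simp
  then have "{d \<in> ?X. loss_norm H 2 (Suc (Suc r)) W w d
      = (INF d\<in>?X. loss_norm H 2 (Suc (Suc r)) W w d)} = ?X"
    by (simp only: Collect_conj_eq Collect_mem_eq) blast
  then show ?case
    by (simp only: optimal_duals.simps(2)[of H 2 W w "Suc r"] Suc.IH)
qed

section \<open>Uniqueness among the optimal duals\<close>

lemma optimal_synthesis_keep:
  assumes "dual_fusion_frame H W w V u Q" and "loss_optimal H (Suc r) 2 W w V u Q"
    and f: "f \<in> direct_sum W"
  shows "synthesis H u (Q (keep {i} f)) = smul H (of_real (1 / w i)) (inv S (f i))"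
proof -
  have Q: "direct_sum_linear H W V Q" using assms(1) by (simp add: dual_fusion_frame_def)
  have fi: "f i \<in> W i" using f by (simp add: direct_sum_def)
  \<comment> \<open>Optimality speaks only about analysis vectors. Since \<open>proj i\<close> fixes
    \<open>f i\<close>, the family \<open>keep {i} f\<close> is \<open>1 / w i\<close> times such a
    vector cut down to component \<open>i\<close>.\<close>
  let ?g = "keep {i} (analysis H W w (f i))"
  have "?g \<in> direct_sum W"
    by (rule keep_in_direct_sum[OF subspaces analysis_in_direct_sum[OF bessel]])
  then have "Q (\<lambda>k. smul H (of_real (1 / w i)) (?g k)) = (\<lambda>k. smul H (of_real (1 / w i)) (Q ?g k))"
    using Q unfolding direct_sum_linear_def by blast
  moreover have "(\<lambda>k. smul H (of_real (1 / w i)) (?g k)) = keep {i} f"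
    using fi by (auto simp: keep_def analysis_def orth_proj_fixes subspace)
  ultimately have "synthesis H u (Q (keep {i} f)) = smul H (of_real (1 / w i)) (synthesis H u (Q ?g))"
    by (simp add: synthesis_scale)
  moreover have "synthesis H u (Q ?g) = inv S (proj i (f i))"
    using assms(2) by (simp add: loss_optimal_def optimal_duals_eq erasure_op_def
        del: optimal_duals.simps)
  ultimately show ?thesis using fi by (simp add: orth_proj_fixes subspace)
qed

lemma optimal_synthesis:
  assumes "dual_fusion_frame H W w V u Q" and "loss_optimal H (Suc r) 2 W w V u Q"
    and f: "f \<in> direct_sum W"
  shows "synthesis H u (Q f) = synthesis H v (Q_D H W w v f)"
proof -
  have "synthesis H u (Q f) = (\<Sum>i\<in>UNIV. synthesis H u (Q (keep {i} f)))"
    using synthesis_keep_sum[OF subspaces _ f, of V Q u UNIV] assms(1)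
    by (simp add: dual_fusion_frame_def)
  then show ?thesis
    by (simp add: optimal_synthesis_keep[OF assms] synthesis_Q_D inv_S.sum inv_S.scale)
qed

text \<open>Component preservation confines \<open>Q (keep {j} f)\<close> to component
  \<open>j\<close>, where synthesis is multiplication by \<open>v j > 0\<close> and therefore
  injective. The known synthesis thus determines \<open>Q\<close>.\<close>

lemma optimal_component_preserving:
  assumes "cp_dual_fusion_frame H W w V v Q" and "loss_optimal H (Suc r) 2 W w V v Q"
  shows "V = (\<lambda>i. inv S ` W i)" and "f \<in> direct_sum W \<Longrightarrow> Q f = Q_D H W w v f"
proof -
  have dual: "dual_fusion_frame H W w V v Q" and cp: "component_preserving W V Q"
    using assms(1) by (auto simp: cp_dual_fusion_frame_def)
  have Q: "direct_sum_linear H W V Q" and V: "\<forall>i. vs.subspace (V i)"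
    using dual by (auto simp: dual_fusion_frame_def fusion_frame_def bessel_fusion_sequence_def)
  have Q_keep: "Q (keep {j} f) = keep {j} (Q_D H W w v f)" if f: "f \<in> direct_sum W" for j f
  proof -
    have "Q (keep {j} f) \<in> keep {j} ` direct_sum V"
      using cp f unfolding component_preserving_def by blast
    then obtain g where g: "Q (keep {j} f) = keep {j} g" by blast
    have "smul H (of_real (v j)) (g j) = smul H (of_real (1 / w j)) (inv S (f j))"
      using optimal_synthesis_keep[OF dual assms(2) f, of j] by (simp add: g synthesis_keep)
    then have "smul H (of_real (1 / v j)) (smul H (of_real (v j)) (g j)) = Q_D H W w v f j"
      by (simp add: Q_D_def mult.commute)
    then have "g j = Q_D H W w v f j" by simp
    then show ?thesis unfolding g by (auto simp: keep_def)
  qed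
  show "Q f = Q_D H W w v f" if f: "f \<in> direct_sum W" for f
  proof -
    have "Q f = (\<lambda>k. \<Sum>i\<in>UNIV. Q (keep {i} f) k)"
      using direct_sum_linear_keep[OF subspaces Q f, of UNIV] by simp
    then show ?thesis by (simp add: Q_keep[OF f]) (simp add: keep_def)
  qed
  have comp: "(\<lambda>g. g j) ` keep {j} ` direct_sum U = U j"
    if U: "\<forall>i. vs.subspace (U i)" for j and U :: "'m \<Rightarrow> 'h set"
    using component_direct_sum[OF U, of j] by (simp add: image_image keep_def)
  \<comment> \<open>\<open>Q\<close> and \<open>Q_D\<close> map component \<open>j\<close> onto the
    same image, from which evaluation at \<open>j\<close> recovers the subspace.\<close>
  have "V j = inv S ` W j" for j
  proof -
    have "keep {j} ` direct_sum V = Q ` keep {j} ` direct_sum W"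
      using cp by (simp add: component_preserving_def)
    also have "\<dots> = Q_D H W w v ` keep {j} ` direct_sum W"
    proof -
      have "keep {j} (Q_D H W w v f) = Q_D H W w v (keep {j} f)" for f
        by (auto simp: keep_def Q_D_def)
      then show ?thesis by (simp add: image_image Q_keep cong: image_cong_simp)
    qed
    also have "\<dots> = keep {j} ` direct_sum (\<lambda>i. inv S ` W i)"
      using Q_D_component_preserving by (simp add: component_preserving_def)
    finally show ?thesis using comp[OF V, of j] comp[of "\<lambda>i. inv S ` W i" j] subspace_image by simp
  qed
  then show "V = (\<lambda>i. inv S ` W i)" by blast
qed

section \<open>Constant weights\<close>

lemma inv_frame_op_const:
  assumes "c \<noteq> 0"
  shows "inv (frame_op H W (\<lambda>_. c)) y = smul H (of_real (1 / c\<^sup>2)) (inv S y)"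
proof (rule inv_f_eq)
  interpret S: Vector_Spaces.linear "smul H" "smul H" S using linear_S by (simp add: linear_op_def)
  \<comment> \<open>Each projection carries \<open>c\<close> twice, once from the analysis and once
    from the synthesis.\<close>
  have op: "frame_op H W (\<lambda>_. c) x = smul H (of_real (c\<^sup>2)) (S x)" for x
    by (simp add: frame_op_def synthesis_def analysis_def S_eq vs.scale_sum_right power2_eq_square)
  show "inj (frame_op H W (\<lambda>_. c))"
    using assms bij_S by (auto simp: op inj_on_def bij_def)
  show "frame_op H W (\<lambda>_. c) (smul H (of_real (1 / c\<^sup>2)) (inv S y)) = y"
    using assms by (simp add: op S.scale)
qed

text \<open>Subspaces absorb nonzero scalars; this removes the factors \<open>1 / c\<close> and
  \<open>1 / c\<^sup>2\<close> from the images below.\<close>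

lemma scale_image_inv_S:
  assumes "c \<noteq> 0"
  shows "(\<lambda>x. smul H c (inv S x)) ` W i = inv S ` W i"
proof (intro equalityI subsetI)
  fix y assume "y \<in> (\<lambda>x. smul H c (inv S x)) ` W i"
  then show "y \<in> inv S ` W i"
    using vs.subspace_scale[OF subspace_image] by auto
next
  fix y assume "y \<in> inv S ` W i"
  then obtain x where x: "x \<in> W i" "y = inv S x" by blast
  have "y = smul H c (inv S (smul H (1 / c) x))"
    using assms by (simp add: x inv_S.scale)
  then show "y \<in> (\<lambda>x. smul H c (inv S x)) ` W i"
    using vs.subspace_scale[OF subspace x(1)] by blast
qed

lemma const_weights:
  assumes "\<forall>i. w i = c"
  shows "inv S ` W i = inv (frame_op H W (\<lambda>_. c)) ` W i"
    and "inv S ` W i =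
      Q_of_spaces W (\<lambda>f. inv (frame_op H W (\<lambda>_. c)) (synthesis H (\<lambda>_. c) f)) i"
    and "Q_D H W w v f =
      Q_of H (\<lambda>f. inv (frame_op H W (\<lambda>_. c)) (synthesis H (\<lambda>_. c) f)) v f"
proof -
  have c: "c \<noteq> 0" using assms w_nonzero by metis
  \<comment> \<open>The factor \<open>c\<close> of the synthesis against
    \<open>1 / c\<^sup>2\<close> of the inverse leaves \<open>1 / c\<close>.\<close>
  have A: "inv (frame_op H W (\<lambda>_. c)) (synthesis H (\<lambda>_. c) (keep {i} f))
      = smul H (of_real (1 / c)) (inv S (f i))" for i f
    using c by (simp add: inv_frame_op_const synthesis_keep inv_S.scale power2_eq_square)
  show "inv S ` W i = inv (frame_op H W (\<lambda>_. c)) ` W i"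
    using c scale_image_inv_S[of "of_real (1 / c\<^sup>2)" i]
    by (simp add: inv_frame_op_const[OF c, abs_def])
  \<comment> \<open>Evaluation at \<open>i\<close> maps \<open>direct_sum W\<close> onto
    \<open>W i\<close>.\<close>
  have "(\<lambda>f. smul H (of_real (1 / c)) (inv S (f i))) ` direct_sum W
      = (\<lambda>x. smul H (of_real (1 / c)) (inv S x)) ` W i"
    by (simp only: component_direct_sum[OF subspaces, of i, symmetric] image_image)
  then show "inv S ` W i =
      Q_of_spaces W (\<lambda>f. inv (frame_op H W (\<lambda>_. c)) (synthesis H (\<lambda>_. c) f)) i"
    using c scale_image_inv_S[of "of_real (1 / c)" i]
    by (simp add: Q_of_spaces_def image_image A)
  show "Q_D H W w v f =
      Q_of H (\<lambda>f. inv (frame_op H W (\<lambda>_. c)) (synthesis H (\<lambda>_. c) f)) v f"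
    using assms by (simp add: Q_of_def Q_D_def A mult.commute)
qed

end

theorem theorem5p1:
  fixes H :: "('k::real_or_complex, 'h::ab_group_add) hilbert_space"
    and W :: "'m::finite \<Rightarrow> 'h set"
    and w v :: "'m \<Rightarrow> real"
    and r :: nat
  assumes "fd_hilbert H"
    and "fusion_frame H W w"
    and "\<forall>i. v i > 0"
    and "r \<in> {1..CARD('m)}"
  shows
    "linear_op H (S_D H W w v) \<and> selfadjoint H (S_D H W w v) \<and>
     positive_op H (S_D H W w v) \<and> bij (S_D H W w v) \<and>
     (loss_optimal H r 2 W w (\<lambda>i. inv (S_D H W w v) ` W i) v (Q_D H W w v) \<and>
      cp_dual_fusion_frame H W w (\<lambda>i. inv (S_D H W w v) ` W i) v (Q_D H W w v)) \<and>
     (\<forall>V Q. dual_fusion_frame H W w V v Q \<and> loss_optimal H r 2 W w V v Q \<longrightarrow>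
        (\<forall>f\<in>direct_sum W. synthesis H v (Q f) = synthesis H v (Q_D H W w v f))) \<and>
     (\<forall>V Q. cp_dual_fusion_frame H W w V v Q \<and> loss_optimal H r 2 W w V v Q \<longrightarrow>
        V = (\<lambda>i. inv (S_D H W w v) ` W i) \<and> (\<forall>f\<in>direct_sum W. Q f = Q_D H W w v f)) \<and>
     (\<forall>w0. (\<forall>i. w i = w0) \<longrightarrow>
        (\<lambda>i. inv (S_D H W w v) ` W i) = (\<lambda>i. inv (frame_op H W (\<lambda>_. w0)) ` W i) \<and>
        (\<lambda>i. inv (S_D H W w v) ` W i) =
          Q_of_spaces W (\<lambda>f. inv (frame_op H W (\<lambda>_. w0)) (synthesis H (\<lambda>_. w0) f)) \<and>
        (\<forall>f\<in>direct_sum W. Q_D H W w v f =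
          Q_of H (\<lambda>f. inv (frame_op H W (\<lambda>_. w0)) (synthesis H (\<lambda>_. w0) f)) v f))"
proof -
  interpret weighted_fusion_frame H W w v
    using assms by (simp add: weighted_fusion_frame_def weighted_fusion_frame_axioms_def)
  \<comment> \<open>Since \<open>r\<close> is at least 1, it lies past stage 0, where
    \<open>optimal_duals_eq\<close> applies.\<close>
  obtain n where r: "r = Suc n" using assms(4) by (cases r) auto
  have opt: "loss_optimal H r 2 W w (\<lambda>i. inv S ` W i) v (Q_D H W w v)"
    unfolding loss_optimal_def r optimal_duals_eq using opt_dual erasure_op_opt_dual by blast
  show ?thesis
    by (intro conjI allI impI ballI linear_S selfadjoint_S positive_S bij_S opt)
      (use opt_dual Q_D_component_preserving optimal_synthesis optimal_component_preserving
        const_weights in \<open>auto simp: cp_dual_fusion_frame_def r\<close>)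
qed


end
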